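(* Let $f,g,F,G:A\to A$ be linear maps any two of which commute. Suppose that $((A,\cdot,\delta),f,F)$ is a commutative and cocommutative Nijenhuis associative D-bialgebra over $K$ and that for all $x,y\in A$ \begin{align*} &f(y)_{[1]}\otimes F(x\cdot f(y)_{[2]})-F(x\cdot f(y)_{[2]})\otimes f(y)_{[1]}+F(x_{[2]})\otimes g(x_{[1]}\cdot y)-g(x_{[1]}\cdot y)\otimes F(x_{[2]})\\ &+G(x)_{[2]}\otimes G(x)_{[1]}\cdot f(y)-G(x)_{[1]}\cdot f(y)\otimes G(x)_{[2]}+G(x)_{[2]}\otimes g(G(x)_{[1]}\cdot y)-g(G(x)_{[1]}\cdot y)\otimes G(x)_{[2]}\\ &+F(y\cdot f(x)_{[2]})\otimes f(x)_{[1]}-f(x)_{[1]}\otimes F(y\cdot f(x)_{[2]})-F(y_{[2]})\otimes g(y_{[1]}\cdot x)+g(y_{[1]}\cdot x)\otimes F(y_{[2]})\\ &-G(y)_{[2]}\otimes G(y)_{[1]}\cdot f(x)+G(y)_{[1]}\cdot f(x)\otimes G(y)_{[2]}-G(y)_{[2]}\otimes g(G(y)_{[1]}\cdot x)+g(G(y)_{[1]}\cdot x)\otimes G(y)_{[2]}=0. \end{align*} Define $[x,y]_{(f,g)}:=x\cdot f(y)+g(x\cdot y)$ and $\Delta_{(F,G)}(x):=x_{[1]}\otimes F(x_{[2]})+G(x)_{[1]}\otimes G(x)_{[2]}$. Then $((A,[,]_{(f,g)},\Delta_{(F,G)}),f,F)$ is a Nijenhuis (special) left Alia bialgebra.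
   Context: All vector spaces are over a field $K$ of characteristic zero. Sweedler notation without summation sign: $\delta(x)=x_{[1]}\otimes x_{[2]}$, $\Delta(x)=x_{(1)}\otimes x_{(2)}$; e.g. $f(y)_{[1]}\otimes f(y)_{[2]}=\delta(f(y))$. $\tau$ is the flip map. No unit or counit is assumed. A Nijenhuis operator on an algebra $(A,\diamond)$ is a linear map $N$ with $N(x)\diamond N(y)+N^2(x\diamond y)=N(N(x)\diamond y+x\diamond N(y))$. A Nijenhuis operator on a space $A$ with comultiplication $\Delta$ is a linear map $S$ with $S(x_{(1)})\otimes S(x_{(2)})+S^2(x)_{(1)}\otimes S^2(x)_{(2)}=S(S(x)_{(1)})\otimes S(x)_{(2)}+S(x)_{(1)}\otimes S(S(x)_{(2)})$ (same for $\delta$). A commutative and cocommutative associative D-bialgebra is $(A,\cdot,\delta)$ with $(A,\cdot)$ commutative associative, $(A,\delta)$ cocommutative coassociative, and $\delta(a\cdot b)=a_{[1]}\cdot b\otimes a_{[2]}+b_{[1]}\otimes a\cdot b_{[2]}$. A commutative and cocommutative Nijenhuis associative D-bialgebra $((A,\cdot,\delta),N,S)$ is such a bialgebra with linear maps $N,S:A\to A$ such that $N$ is a Nijenhuis operator on $(A,\cdot)$, $S$ is a Nijenhuis operator on $(A,\delta)$, and for all $x,y\in A$ $$S(N(x)\cdot y)+x\cdot S^2(y)=N(x)\cdot S(y)+S(x\cdot S(y)),$$ $$S(N(x)_{[1]})\otimes N(x)_{[2]}+x_{[1]}\otimes N^2(x_{[2]})=S(x_{[1]})\otimes N(x_{[2]})+N(x)_{[1]}\otimes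 N(N(x)_{[2]}).$$ A left Alia algebra is $(A,[,])$ with $[,]$ bilinear and $[[x,y],z]+[[y,z],x]+[[z,x],y]=[[y,x],z]+[[z,y],x]+[[x,z],y]$. A left Alia coalgebra is $(A,\Delta)$ with $$x_{(1)(2)}\otimes x_{(1)(1)}\otimes x_{(2)}+x_{(1)(1)}\otimes x_{(2)}\otimes x_{(1)(2)}+x_{(2)}\otimes x_{(1)(2)}\otimes x_{(1)(1)}=x_{(1)(1)}\otimes x_{(1)(2)}\otimes x_{(2)}+x_{(1)(2)}\otimes x_{(2)}\otimes x_{(1)(1)}+x_{(2)}\otimes x_{(1)(1)}\otimes x_{(1)(2)},$$ where $x_{(1)(1)}\otimes x_{(1)(2)}\otimes x_{(2)}=(\Delta\otimes\mathrm{id})\Delta(x)$. A left Alia bialgebra is $(A,[,],\Delta)$ with $(A,[,])$ a left Alia algebra, $(A,\Delta)$ a left Alia coalgebra and $(\tau-\mathrm{id}^{\otimes 2})(\Delta([x,y]-[y,x]))=(\tau-\mathrm{id}^{\otimes 2})((\mathcal R(y)\otimes\mathrm{id})\Delta(x)-(\mathcal R(x)\otimes\mathrm{id})\Delta(y))$, where $\mathcal R(y)z=[z,y]$. A Nijenhuis left Alia bialgebra $((A,[,],\Delta),N,S)$ is a left Alia bialgebra with linear maps $N,S:A\to A$ such that $N$ is a Nijenhuis operator on $(A,[,])$, $S$ is a Nijenhuis operator on $(A,\Delta)$, and for all $x,y\in A$: $S[N(x),y]+[x,S^2(y)]=S[x,S(y)]+[N(x),S(y)]$; $S[x,N(y)]+[S^2(x),y]=S[S(x),y]+[S(x),N(y)]$;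 $S(N(x)_{(1)})\otimes N(x)_{(2)}+x_{(1)}\otimes N^2(x_{(2)})=S(x_{(1)})\otimes N(x_{(2)})+N(x)_{(1)}\otimes N(N(x)_{(2)})$; $N(x)_{(1)}\otimes S(N(x)_{(2)})+N^2(x_{(1)})\otimes x_{(2)}=N(x_{(1)})\otimes S(x_{(2)})+N(N(x)_{(1)})\otimes N(x)_{(2)}$. *)

theory Defs
  imports Complex_Main "HOL-Library.Poly_Mapping"
begin

text \<open>
  A vector space over a field is given, as in the library theory of vector spaces, by a scalar
  multiplication \<open>s\<close> satisfying \<open>vector_space s\<close>. Its tensor powers are quotients of free vector
  spaces: an element of \<open>A \<otimes> A\<close> is a class of formal linear combinations of pairs, modulo the span
  of the bilinearity relations, and likewise with triples for \<open>A \<otimes> A \<otimes> A\<close>.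
\<close>

section \<open>Formal linear combinations\<close>

definition fscale :: "'k::field \<Rightarrow> ('x \<Rightarrow>\<^sub>0 'k) \<Rightarrow> ('x \<Rightarrow>\<^sub>0 'k)" where
  "fscale c p = Poly_Mapping.map ((*) c) p"

lemma lookup_fscale [simp]: "Poly_Mapping.lookup (fscale c p) x = c * Poly_Mapping.lookup p x"
  by (simp add: fscale_def Poly_Mapping.map.rep_eq when_def)

lemma vector_space_fscale: "vector_space (fscale :: 'k::field \<Rightarrow> ('x \<Rightarrow>\<^sub>0 'k) \<Rightarrow> _)"
  by unfold_locales
     (auto intro!: poly_mapping_eqI simp: lookup_add algebra_simps)

text \<open>The linear extension of a map defined on the basis of a free vector space.\<close>

definition linear_ext :: "('x \<Rightarrow> ('y \<Rightarrow>\<^sub>0 'k::field)) \<Rightarrow> ('x \<Rightarrow>\<^sub>0 'k) \<Rightarrow> ('y \<Rightarrow>\<^sub>0 'k)" where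
  "linear_ext h p = (\<Sum>x\<in>Poly_Mapping.keys p. fscale (Poly_Mapping.lookup p x) (h x))"

definition tensor2 :: "'a \<Rightarrow> 'b \<Rightarrow> ('a \<times> 'b \<Rightarrow>\<^sub>0 'k::field)"  (infixr "\<otimes>" 75) where
  "a \<otimes> b = Poly_Mapping.single (a, b) 1"

definition tensor3 :: "'a \<Rightarrow> 'b \<Rightarrow> 'c \<Rightarrow> ('a \<times> 'b \<times> 'c \<Rightarrow>\<^sub>0 'k::field)" where
  "tensor3 a b c = Poly_Mapping.single (a, b, c) 1"

definition flip :: "('a \<times> 'b \<Rightarrow>\<^sub>0 'k::field) \<Rightarrow> ('b \<times> 'a \<Rightarrow>\<^sub>0 'k)" where
  "flip = linear_ext (\<lambda>(a, b). b \<otimes> a)"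


section \<open>The tensor square and cube\<close>

definition relations2 :: "('k::field \<Rightarrow> 'a::ab_group_add \<Rightarrow> 'a) \<Rightarrow> ('a \<times> 'a \<Rightarrow>\<^sub>0 'k) set" where
  "relations2 s =
     {(a + a') \<otimes> b - a \<otimes> b - a' \<otimes> b | a a' b. True} \<union>
     {a \<otimes> (b + b') - a \<otimes> b - a \<otimes> b' | a b b'. True} \<union>
     {s c a \<otimes> b - fscale c (a \<otimes> b) | c a b. True} \<union>
     {a \<otimes> s c b - fscale c (a \<otimes> b) | c a b. True}"

definition relations3 :: "('k::field \<Rightarrow> 'a::ab_group_add \<Rightarrow> 'a) \<Rightarrow> ('a \<times> 'a \<times> 'a \<Rightarrow>\<^sub>0 'k) set" where
  "relations3 s =
     {tensor3 (a + a') b c - tensor3 a b c - tensor3 a' b c | a a' b c. True} \<union>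
     {tensor3 a (b + b') c - tensor3 a b c - tensor3 a b' c | a b b' c. True} \<union>
     {tensor3 a b (c + c') - tensor3 a b c - tensor3 a b c' | a b c c'. True} \<union>
     {tensor3 (s k a) b c - fscale k (tensor3 a b c) | k a b c. True} \<union>
     {tensor3 a (s k b) c - fscale k (tensor3 a b c) | k a b c. True} \<union>
     {tensor3 a b (s k c) - fscale k (tensor3 a b c) | k a b c. True}"

definition class2 :: "('k::field \<Rightarrow> 'a::ab_group_add \<Rightarrow> 'a) \<Rightarrow>
    ('a \<times> 'a \<Rightarrow>\<^sub>0 'k) \<Rightarrow> ('a \<times> 'a \<Rightarrow>\<^sub>0 'k) set" where
  "class2 s p = {q. q - p \<in> module.span fscale (relations2 s)}"

definition class3 :: "('k::field \<Rightarrow> 'a::ab_group_add \<Rightarrow> 'a) \<Rightarrow>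
    ('a \<times> 'a \<times> 'a \<Rightarrow>\<^sub>0 'k) \<Rightarrow> ('a \<times> 'a \<times> 'a \<Rightarrow>\<^sub>0 'k) set" where
  "class3 s p = {q. q - p \<in> module.span fscale (relations3 s)}"

lemma class2_eq_iff: "class2 s p = class2 s q \<longleftrightarrow> p - q \<in> module.span fscale (relations2 s)"
proof -
  interpret V: vector_space "fscale :: 'k::field \<Rightarrow> ('a \<times> 'a \<Rightarrow>\<^sub>0 'k) \<Rightarrow> _"
    by (rule vector_space_fscale)
  show ?thesis
  proof
    assume "class2 s p = class2 s q"
    moreover have "p \<in> class2 s p" by (simp add: class2_def V.span_zero)
    ultimately show "p - q \<in> V.span (relations2 s)" by (simp add: class2_def)
  next
    assume pq: "p - q \<in> V.span (relations2 s)"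
    have "r - p \<in> V.span (relations2 s) \<longleftrightarrow> r - q \<in> V.span (relations2 s)" for r
      using V.span_add[OF _ pq, of "r - p"] V.span_diff[OF _ pq, of "r - q"] by auto
    then show "class2 s p = class2 s q" by (simp add: class2_def)
  qed
qed

lemma class3_eq_iff: "class3 s p = class3 s q \<longleftrightarrow> p - q \<in> module.span fscale (relations3 s)"
proof -
  interpret V: vector_space "fscale :: 'k::field \<Rightarrow> ('a \<times> 'a \<times> 'a \<Rightarrow>\<^sub>0 'k) \<Rightarrow> _"
    by (rule vector_space_fscale)
  show ?thesis
  proof
    assume "class3 s p = class3 s q"
    moreover have "p \<in> class3 s p" by (simp add: class3_def V.span_zero)
    ultimately show "p - q \<in> V.span (relations3 s)" by (simp add: class3_def)
  next
    assume pq: "p - q \<in> V.span (relations3 s)"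
    have "r - p \<in> V.span (relations3 s) \<longleftrightarrow> r - q \<in> V.span (relations3 s)" for r
      using V.span_add[OF _ pq, of "r - p"] V.span_diff[OF _ pq, of "r - q"] by auto
    then show "class3 s p = class3 s q" by (simp add: class3_def)
  qed
qed

definition tensor_square :: "('k::field \<Rightarrow> 'a::ab_group_add \<Rightarrow> 'a) \<Rightarrow> ('a \<times> 'a \<Rightarrow>\<^sub>0 'k) set set" where
  "tensor_square s = range (class2 s)"

text \<open>
  Sweedler notation: for \<open>T \<in> A \<otimes> A\<close> with representative \<open>\<Sum>\<^sub>i c\<^sub>i (a\<^sub>i, b\<^sub>i)\<close>, the term
  \<open>sweedler T (\<lambda>a b. h a b)\<close> is the formal sum \<open>\<Sum>\<^sub>i c\<^sub>i h(a\<^sub>i, b\<^sub>i)\<close>. It is only used under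
  \<open>class2\<close> or \<open>class3\<close> and with \<open>h\<close> bilinear modulo the respective relations, and then the class of
  the result does not depend on the representative; see \<open>class2_sweedler\<close> and \<open>class3_sweedler\<close>.
\<close>

definition rep :: "('a \<times> 'a \<Rightarrow>\<^sub>0 'k::field) set \<Rightarrow> ('a \<times> 'a \<Rightarrow>\<^sub>0 'k)" where
  "rep T = (SOME p. p \<in> T)"

definition sweedler :: "('a \<times> 'a \<Rightarrow>\<^sub>0 'k::field) set \<Rightarrow> ('a \<Rightarrow> 'a \<Rightarrow> ('y \<Rightarrow>\<^sub>0 'k)) \<Rightarrow> ('y \<Rightarrow>\<^sub>0 'k)" where
  "sweedler T h = linear_ext (\<lambda>(a, b). h a b) (rep T)"

lemma linear_ext_superset:
  fixes h :: "'x \<Rightarrow> ('y \<Rightarrow>\<^sub>0 'k::field)"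
  assumes "finite X" "Poly_Mapping.keys p \<subseteq> X"
  shows "linear_ext h p = (\<Sum>x\<in>X. fscale (Poly_Mapping.lookup p x) (h x))"
proof -
  interpret V: vector_space "fscale :: 'k::field \<Rightarrow> ('y \<Rightarrow>\<^sub>0 'k) \<Rightarrow> _"
    by (rule vector_space_fscale)
  show ?thesis unfolding linear_ext_def
    by (rule sum.mono_neutral_left) (use assms in \<open>auto simp: in_keys_iff\<close>)
qed

lemma linear_linear_ext:
  fixes h :: "'x \<Rightarrow> ('y \<Rightarrow>\<^sub>0 'k::field)"
  shows "Vector_Spaces.linear fscale fscale (linear_ext h)"
proof -
  interpret V: vector_space "fscale :: 'k::field \<Rightarrow> ('y \<Rightarrow>\<^sub>0 'k) \<Rightarrow> _"
    by (rule vector_space_fscale)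
  interpret W: vector_space "fscale :: 'k::field \<Rightarrow> ('x \<Rightarrow>\<^sub>0 'k) \<Rightarrow> _"
    by (rule vector_space_fscale)
  show ?thesis
  proof unfold_locales
    fix p q :: "'x \<Rightarrow>\<^sub>0 'k" and c :: 'k
    let ?X = "Poly_Mapping.keys p \<union> Poly_Mapping.keys q"
    have "Poly_Mapping.keys (p + q) \<subseteq> ?X" by (rule Poly_Mapping.keys_add)
    then show "linear_ext h (p + q) = linear_ext h p + linear_ext h q"
      by (simp add: linear_ext_superset[of ?X] lookup_add V.scale_left_distrib sum.distrib)
    have "Poly_Mapping.keys (fscale c p) \<subseteq> Poly_Mapping.keys p" by (auto simp: in_keys_iff)
    then show "linear_ext h (fscale c p) = fscale c (linear_ext h p)"
      by (simp add: linear_ext_superset[of "Poly_Mapping.keys p"] V.scale_sum_right)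
  qed
qed

lemma linear_ext_tensor2 [simp]:
  fixes h :: "'a \<times> 'b \<Rightarrow> ('y \<Rightarrow>\<^sub>0 'k::field)"
  shows "linear_ext h (a \<otimes> b) = h (a, b)"
proof -
  interpret V: vector_space "fscale :: 'k::field \<Rightarrow> ('y \<Rightarrow>\<^sub>0 'k) \<Rightarrow> _"
    by (rule vector_space_fscale)
  show ?thesis by (simp add: linear_ext_def tensor2_def)
qed

lemma linear_ext_relations2:
  fixes h :: "'a::ab_group_add \<Rightarrow> 'a \<Rightarrow> ('y \<Rightarrow>\<^sub>0 'k::field)"
  assumes "module.subspace fscale W"
    and "\<And>a a' b. h (a + a') b - h a b - h a' b \<in> W"
    and "\<And>a b b'. h a (b + b') - h a b - h a b' \<in> W"
    and "\<And>c a b. h (s c a) b - fscale c (h a b) \<in> W"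
    and "\<And>c a b. h a (s c b) - fscale c (h a b) \<in> W"
    and "p \<in> module.span fscale (relations2 s)"
  shows "linear_ext (\<lambda>(a, b). h a b) p \<in> W"
proof -
  interpret L: Vector_Spaces.linear fscale fscale "linear_ext (\<lambda>(a, b). h a b)"
    by (rule linear_linear_ext)
  show ?thesis
    using assms(6)
  proof (induction rule: L.vs1.span_induct)
    case base
    show ?case
      using L.subspace_vimage[OF assms(1)] by (simp add: vimage_def)
  next
    case (step x)
    then show ?case
      using assms(2-5) by (auto simp: relations2_def L.diff L.scale)
  qed
qed

lemma class2_sweedler:
  fixes h :: "'a::ab_group_add \<Rightarrow> 'a \<Rightarrow> ('a \<times> 'a \<Rightarrow>\<^sub>0 'k::field)"
    and s :: "'k \<Rightarrow> 'a \<Rightarrow> 'a"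
  defines "W \<equiv> module.span fscale (relations2 s)"
  assumes "\<And>a a' b. h (a + a') b - h a b - h a' b \<in> W"
    and "\<And>a b b'. h a (b + b') - h a b - h a b' \<in> W"
    and "\<And>c a b. h (s c a) b - fscale c (h a b) \<in> W"
    and "\<And>c a b. h a (s c b) - fscale c (h a b) \<in> W"
  shows "class2 s (sweedler (class2 s p) h) = class2 s (linear_ext (\<lambda>(a, b). h a b) p)"
proof -
  interpret L: Vector_Spaces.linear fscale fscale "linear_ext (\<lambda>(a, b). h a b)"
    by (rule linear_linear_ext)
  have "p \<in> class2 s p" by (simp add: class2_def L.vs1.span_zero)
  then have "rep (class2 s p) \<in> class2 s p" unfolding rep_def by (rule someI)
  then have "rep (class2 s p) - p \<in> L.vs1.span (relations2 s)" by (simp add: class2_def)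
  with assms have "linear_ext (\<lambda>(a, b). h a b) (rep (class2 s p) - p) \<in> W"
    by (intro linear_ext_relations2[where s = s]) (auto simp: L.vs1.subspace_span)
  then show ?thesis by (simp add: class2_eq_iff sweedler_def W_def L.diff)
qed

lemma class3_sweedler:
  fixes h :: "'a::ab_group_add \<Rightarrow> 'a \<Rightarrow> ('a \<times> 'a \<times> 'a \<Rightarrow>\<^sub>0 'k::field)"
    and s :: "'k \<Rightarrow> 'a \<Rightarrow> 'a"
  defines "W \<equiv> module.span fscale (relations3 s)"
  assumes "\<And>a a' b. h (a + a') b - h a b - h a' b \<in> W"
    and "\<And>a b b'. h a (b + b') - h a b - h a b' \<in> W"
    and "\<And>c a b. h (s c a) b - fscale c (h a b) \<in> W"
    and "\<And>c a b. h a (s c b) - fscale c (h a b) \<in> W"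
  shows "class3 s (sweedler (class2 s p) h) = class3 s (linear_ext (\<lambda>(a, b). h a b) p)"
proof -
  interpret L: Vector_Spaces.linear fscale fscale "linear_ext (\<lambda>(a, b). h a b)"
    by (rule linear_linear_ext)
  have "p \<in> class2 s p" by (simp add: class2_def L.vs1.span_zero)
  then have "rep (class2 s p) \<in> class2 s p" unfolding rep_def by (rule someI)
  then have "rep (class2 s p) - p \<in> L.vs1.span (relations2 s)" by (simp add: class2_def)
  with assms have "linear_ext (\<lambda>(a, b). h a b) (rep (class2 s p) - p) \<in> W"
    by (intro linear_ext_relations2[where s = s]) (auto simp: L.vs2.subspace_span)
  then show ?thesis by (simp add: class3_eq_iff sweedler_def W_def L.diff)
qed


section \<open>Algebras and coalgebras\<close>

definition bilinear_op :: "('k::field \<Rightarrow> 'a::ab_group_add \<Rightarrow> 'a) \<Rightarrow> ('a \<Rightarrow> 'a \<Rightarrow> 'a) \<Rightarrow> bool" where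
  "bilinear_op s m \<longleftrightarrow>
     (\<forall>x. Vector_Spaces.linear s s (\<lambda>y. m x y)) \<and> (\<forall>y. Vector_Spaces.linear s s (\<lambda>x. m x y))"

text \<open>Linear maps from \<open>A\<close> to \<open>A \<otimes> A\<close>; the vector space operations of the quotient are performed
  on representatives.\<close>

definition comultiplication :: "('k::field \<Rightarrow> 'a::ab_group_add \<Rightarrow> 'a) \<Rightarrow>
    ('a \<Rightarrow> ('a \<times> 'a \<Rightarrow>\<^sub>0 'k) set) \<Rightarrow> bool" where
  "comultiplication s \<Delta> \<longleftrightarrow>
     (\<forall>x. \<Delta> x \<in> tensor_square s) \<and>
     (\<forall>x y. \<Delta> (x + y) = class2 s (rep (\<Delta> x) + rep (\<Delta> y))) \<and>
     (\<forall>c x. \<Delta> (s c x) = class2 s (fscale c (rep (\<Delta> x))))"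

definition nijenhuis_operator :: "('k::field \<Rightarrow> 'a::ab_group_add \<Rightarrow> 'a) \<Rightarrow> ('a \<Rightarrow> 'a \<Rightarrow> 'a) \<Rightarrow>
    ('a \<Rightarrow> 'a) \<Rightarrow> bool" where
  "nijenhuis_operator s m N \<longleftrightarrow>
     Vector_Spaces.linear s s N \<and>
     (\<forall>x y. m (N x) (N y) + N (N (m x y)) = N (m (N x) y + m x (N y)))"

definition nijenhuis_cooperator :: "('k::field \<Rightarrow> 'a::ab_group_add \<Rightarrow> 'a) \<Rightarrow>
    ('a \<Rightarrow> ('a \<times> 'a \<Rightarrow>\<^sub>0 'k) set) \<Rightarrow> ('a \<Rightarrow> 'a) \<Rightarrow> bool" where
  "nijenhuis_cooperator s \<Delta> S \<longleftrightarrow>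
     Vector_Spaces.linear s s S \<and>
     (\<forall>x. class2 s (sweedler (\<Delta> x) (\<lambda>x1 x2. S x1 \<otimes> S x2)
                    + sweedler (\<Delta> (S (S x))) (\<lambda>z1 z2. z1 \<otimes> z2))
        = class2 s (sweedler (\<Delta> (S x)) (\<lambda>z1 z2. S z1 \<otimes> z2)
                    + sweedler (\<Delta> (S x)) (\<lambda>z1 z2. z1 \<otimes> S z2)))"


section \<open>Commutative and cocommutative Nijenhuis associative D-bialgebras\<close>

definition comm_assoc_algebra :: "('k::field \<Rightarrow> 'a::ab_group_add \<Rightarrow> 'a) \<Rightarrow> ('a \<Rightarrow> 'a \<Rightarrow> 'a) \<Rightarrow> bool" where
  "comm_assoc_algebra s m \<longleftrightarrow>
     bilinear_op s m \<and>
     (\<forall>x y. m x y = m y x) \<and>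
     (\<forall>x y z. m (m x y) z = m x (m y z))"

definition cocomm_coassoc_coalgebra :: "('k::field \<Rightarrow> 'a::ab_group_add \<Rightarrow> 'a) \<Rightarrow>
    ('a \<Rightarrow> ('a \<times> 'a \<Rightarrow>\<^sub>0 'k) set) \<Rightarrow> bool" where
  "cocomm_coassoc_coalgebra s \<delta> \<longleftrightarrow>
     comultiplication s \<delta> \<and>
     (\<forall>x. class2 s (sweedler (\<delta> x) (\<lambda>x1 x2. x2 \<otimes> x1)) = \<delta> x) \<and>
     (\<forall>x. class3 s (sweedler (\<delta> x) (\<lambda>x1 x2. sweedler (\<delta> x1) (\<lambda>x11 x12. tensor3 x11 x12 x2)))
        = class3 s (sweedler (\<delta> x) (\<lambda>x1 x2. sweedler (\<delta> x2) (\<lambda>x21 x22. tensor3 x1 x21 x22))))"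

definition assoc_D_bialgebra :: "('k::field \<Rightarrow> 'a::ab_group_add \<Rightarrow> 'a) \<Rightarrow> ('a \<Rightarrow> 'a \<Rightarrow> 'a) \<Rightarrow>
    ('a \<Rightarrow> ('a \<times> 'a \<Rightarrow>\<^sub>0 'k) set) \<Rightarrow> bool" where
  "assoc_D_bialgebra s m \<delta> \<longleftrightarrow>
     comm_assoc_algebra s m \<and>
     cocomm_coassoc_coalgebra s \<delta> \<and>
     (\<forall>a b. \<delta> (m a b) = class2 s (sweedler (\<delta> a) (\<lambda>a1 a2. m a1 b \<otimes> a2)
                               + sweedler (\<delta> b) (\<lambda>b1 b2. b1 \<otimes> m a b2)))"

definition nijenhuis_assoc_D_bialgebra :: "('k::field \<Rightarrow> 'a::ab_group_add \<Rightarrow> 'a) \<Rightarrow>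
    ('a \<Rightarrow> 'a \<Rightarrow> 'a) \<Rightarrow> ('a \<Rightarrow> ('a \<times> 'a \<Rightarrow>\<^sub>0 'k) set) \<Rightarrow> ('a \<Rightarrow> 'a) \<Rightarrow> ('a \<Rightarrow> 'a) \<Rightarrow> bool" where
  "nijenhuis_assoc_D_bialgebra s m \<delta> N S \<longleftrightarrow>
     assoc_D_bialgebra s m \<delta> \<and>
     nijenhuis_operator s m N \<and>
     nijenhuis_cooperator s \<delta> S \<and>
     (\<forall>x y. S (m (N x) y) + m x (S (S y)) = m (N x) (S y) + S (m x (S y))) \<and>
     (\<forall>x. class2 s (sweedler (\<delta> (N x)) (\<lambda>z1 z2. S z1 \<otimes> z2)
                    + sweedler (\<delta> x) (\<lambda>x1 x2. x1 \<otimes> N (N x2)))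
        = class2 s (sweedler (\<delta> x) (\<lambda>x1 x2. S x1 \<otimes> N x2)
                    + sweedler (\<delta> (N x)) (\<lambda>z1 z2. z1 \<otimes> N z2)))"


section \<open>Nijenhuis left Alia bialgebras\<close>

definition left_alia_algebra :: "('k::field \<Rightarrow> 'a::ab_group_add \<Rightarrow> 'a) \<Rightarrow> ('a \<Rightarrow> 'a \<Rightarrow> 'a) \<Rightarrow> bool" where
  "left_alia_algebra s br \<longleftrightarrow>
     bilinear_op s br \<and>
     (\<forall>x y z. br (br x y) z + br (br y z) x + br (br z x) y
            = br (br y x) z + br (br z y) x + br (br x z) y)"

definition left_alia_coalgebra :: "('k::field \<Rightarrow> 'a::ab_group_add \<Rightarrow> 'a) \<Rightarrow>
    ('a \<Rightarrow> ('a \<times> 'a \<Rightarrow>\<^sub>0 'k) set) \<Rightarrow> bool" where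
  "left_alia_coalgebra s \<Delta> \<longleftrightarrow>
     comultiplication s \<Delta> \<and>
     (\<forall>x. class3 s (sweedler (\<Delta> x) (\<lambda>x1 x2. sweedler (\<Delta> x1) (\<lambda>x11 x12.
              tensor3 x12 x11 x2 + tensor3 x11 x2 x12 + tensor3 x2 x12 x11)))
        = class3 s (sweedler (\<Delta> x) (\<lambda>x1 x2. sweedler (\<Delta> x1) (\<lambda>x11 x12.
              tensor3 x11 x12 x2 + tensor3 x12 x2 x11 + tensor3 x2 x11 x12))))"

text \<open>In the compatibility condition, \<open>flip P - P\<close> is the image of \<open>P\<close> under \<open>\<tau> - id \<otimes> id\<close>.\<close>

definition left_alia_bialgebra :: "('k::field \<Rightarrow> 'a::ab_group_add \<Rightarrow> 'a) \<Rightarrow> ('a \<Rightarrow> 'a \<Rightarrow> 'a) \<Rightarrow>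
    ('a \<Rightarrow> ('a \<times> 'a \<Rightarrow>\<^sub>0 'k) set) \<Rightarrow> bool" where
  "left_alia_bialgebra s br \<Delta> \<longleftrightarrow>
     left_alia_algebra s br \<and>
     left_alia_coalgebra s \<Delta> \<and>
     (\<forall>x y. let P = sweedler (\<Delta> (br x y - br y x)) (\<lambda>z1 z2. z1 \<otimes> z2);
                Q = sweedler (\<Delta> x) (\<lambda>x1 x2. br x1 y \<otimes> x2) - sweedler (\<Delta> y) (\<lambda>y1 y2. br y1 x \<otimes> y2)
            in class2 s (flip P - P) = class2 s (flip Q - Q))"

definition nijenhuis_left_alia_bialgebra :: "('k::field \<Rightarrow> 'a::ab_group_add \<Rightarrow> 'a) \<Rightarrow>
    ('a \<Rightarrow> 'a \<Rightarrow> 'a) \<Rightarrow> ('a \<Rightarrow> ('a \<times> 'a \<Rightarrow>\<^sub>0 'k) set) \<Rightarrow> ('a \<Rightarrow> 'a) \<Rightarrow> ('a \<Rightarrow> 'a) \<Rightarrow> bool" where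
  "nijenhuis_left_alia_bialgebra s br \<Delta> N S \<longleftrightarrow>
     left_alia_bialgebra s br \<Delta> \<and>
     nijenhuis_operator s br N \<and>
     nijenhuis_cooperator s \<Delta> S \<and>
     (\<forall>x y. S (br (N x) y) + br x (S (S y)) = S (br x (S y)) + br (N x) (S y)) \<and>
     (\<forall>x y. S (br x (N y)) + br (S (S x)) y = S (br (S x) y) + br (S x) (N y)) \<and>
     (\<forall>x. class2 s (sweedler (\<Delta> (N x)) (\<lambda>z1 z2. S z1 \<otimes> z2)
                    + sweedler (\<Delta> x) (\<lambda>x1 x2. x1 \<otimes> N (N x2)))
        = class2 s (sweedler (\<Delta> x) (\<lambda>x1 x2. S x1 \<otimes> N x2)
                    + sweedler (\<Delta> (N x)) (\<lambda>z1 z2. z1 \<otimes> N z2))) \<and>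
     (\<forall>x. class2 s (sweedler (\<Delta> (N x)) (\<lambda>z1 z2. z1 \<otimes> S z2)
                    + sweedler (\<Delta> x) (\<lambda>x1 x2. N (N x1) \<otimes> x2))
        = class2 s (sweedler (\<Delta> x) (\<lambda>x1 x2. N x1 \<otimes> S x2)
                    + sweedler (\<Delta> (N x)) (\<lambda>z1 z2. N z1 \<otimes> z2)))"


section \<open>The special bracket and comultiplication\<close>

text \<open>A left Alia structure is called special with respect to \<open>(m, f, g)\<close>, resp. \<open>(\<delta>, F, G)\<close>, when
  its bracket, resp. comultiplication, has the following form.\<close>

definition special_bracket :: "('a::ab_group_add \<Rightarrow> 'a \<Rightarrow> 'a) \<Rightarrow> ('a \<Rightarrow> 'a) \<Rightarrow> ('a \<Rightarrow> 'a) \<Rightarrow>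
    'a \<Rightarrow> 'a \<Rightarrow> 'a" where
  "special_bracket m f g x y = m x (f y) + g (m x y)"

definition special_comultiplication :: "('k::field \<Rightarrow> 'a::ab_group_add \<Rightarrow> 'a) \<Rightarrow>
    ('a \<Rightarrow> ('a \<times> 'a \<Rightarrow>\<^sub>0 'k) set) \<Rightarrow> ('a \<Rightarrow> 'a) \<Rightarrow> ('a \<Rightarrow> 'a) \<Rightarrow>
    'a \<Rightarrow> ('a \<times> 'a \<Rightarrow>\<^sub>0 'k) set" where
  "special_comultiplication s \<delta> F G x =
     class2 s (sweedler (\<delta> x) (\<lambda>x1 x2. x1 \<otimes> F x2) + sweedler (\<delta> (G x)) (\<lambda>z1 z2. z1 \<otimes> z2))"

end

theory Submission
  imports Defs
begin

text \<open>
  Two elements of \<open>A \<otimes> A\<close> over a field are equal as soon as every bilinear form takes the same value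
  on them, and likewise for \<open>A \<otimes> A \<otimes> A\<close> and trilinear forms. So every identity in Sweedler notation
  may be tested against an arbitrary form \<open>\<phi>\<close>, which turns it into an identity between scalars
  \<open>\<Sum> \<phi>(x\<^sub>1, x\<^sub>2)\<close> with \<open>\<delta>(x) = \<Sum> x\<^sub>1 \<otimes> x\<^sub>2\<close>: the quotient and the choice of representatives
  disappear, and each axiom of the coalgebra becomes a rule for such scalars
  (\<open>class2_eq_iff_pairing\<close>, \<open>class3_eq_iff_pairing\<close>, \<open>contract_special\<close>).

  Algebra. Since \<open>m\<close> is commutative, the \<open>g\<close>-parts cancel in the commutator of the bracket, which
  is \<open>m x (f y) - m y (f x)\<close>. In the cyclic sum of the brackets of these commutators with the third
  variable, every product occurs twice with opposite signs (\<open>left_alia_algebra_bracket\<close>).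

  Coalgebra. Dually, \<open>\<Delta>\<close> composed with an alternating form only sees \<open>id \<otimes> F\<close>, because \<open>\<delta>\<close> is
  cocommutative. The left Alia identity pairs \<open>\<Delta> \<otimes> id\<close> after \<open>\<Delta>\<close> with an alternating trilinear form
  \<open>\<chi>\<close>. What remains are the iterated comultiplication of \<open>x\<close> paired with \<open>\<chi> a (F b) (F c)\<close> and that
  of \<open>G x\<close> paired with \<open>\<chi> a (F b) c\<close>. The iterated comultiplication is symmetric in its three
  factors, whereas each of these forms is antisymmetric in two of its arguments, so both pairings
  are zero (\<open>left_alia_coalgebra_special\<close>).

  Nijenhuis conditions. Each of them for the bracket, or for \<open>\<Delta>\<close>, is the sum of two instances of a
  condition for \<open>m\<close>, or for \<open>\<delta>\<close>: one for either summand of \<open>m x (f y) + g (m x y)\<close>, or of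
  \<open>(id \<otimes> F) \<delta> + \<delta> G\<close>. The outer maps \<open>g\<close> and \<open>id \<otimes> F\<close> are applied to the whole instance, and the
  commutation hypotheses then bring it into the required form.

  Compatibility. By cocommutativity, antisymmetrising \<open>\<Delta>\<close> gives \<open>(F \<otimes> id - id \<otimes> F) \<delta>\<close>. Expanding this
  at the commutator by the D-bialgebra axiom, the difference of the two sides is exactly the
  sixteen-term expression whose vanishing is assumed (\<open>special_compatibility\<close>).
\<close>

section \<open>Functionals separate the points of a quotient\<close>

text \<open>
  Every linear functional on the free vector space over \<open>'x\<close> has this form, with \<open>\<phi>\<close> its restriction
  to the basis; see \<open>linear_eq_pairing\<close>.
\<close>

definition pairing :: "('x \<Rightarrow> 'k::field) \<Rightarrow> ('x \<Rightarrow>\<^sub>0 'k) \<Rightarrow> 'k" where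
  "pairing \<phi> p = (\<Sum>x\<in>Poly_Mapping.keys p. Poly_Mapping.lookup p x * \<phi> x)"

lemma pairing_superset:
  assumes "finite X" "Poly_Mapping.keys p \<subseteq> X"
  shows "pairing \<phi> p = (\<Sum>x\<in>X. Poly_Mapping.lookup p x * \<phi> x)"
  unfolding pairing_def
  by (rule sum.mono_neutral_left) (use assms in \<open>auto simp: in_keys_iff\<close>)

lemma linear_pairing: "Vector_Spaces.linear fscale (*) (pairing \<phi>)"
proof -
  interpret V: vector_space "fscale :: 'a::field \<Rightarrow> ('b \<Rightarrow>\<^sub>0 'a) \<Rightarrow> _"
    by (rule vector_space_fscale)
  show ?thesis
  proof unfold_locales
    fix p q :: "'b \<Rightarrow>\<^sub>0 'a" and c :: 'a
    let ?X = "Poly_Mapping.keys p \<union> Poly_Mapping.keys q"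
    have "Poly_Mapping.keys (p + q) \<subseteq> ?X" by (rule Poly_Mapping.keys_add)
    then show "pairing \<phi> (p + q) = pairing \<phi> p + pairing \<phi> q"
      by (simp add: pairing_superset[of ?X] lookup_add distrib_right sum.distrib)
    have "Poly_Mapping.keys (fscale c p) \<subseteq> Poly_Mapping.keys p" by (auto simp: in_keys_iff)
    then show "pairing \<phi> (fscale c p) = c * pairing \<phi> p"
      by (simp add: pairing_superset[of "Poly_Mapping.keys p"] sum_distrib_left mult.assoc)
  qed (simp_all add: algebra_simps)
qed

lemma pairing_simps [simp]:
  "pairing \<phi> 0 = 0"
  "pairing \<phi> (p + q) = pairing \<phi> p + pairing \<phi> q"
  "pairing \<phi> (p - q) = pairing \<phi> p - pairing \<phi> q"
  "pairing \<phi> (fscale c p) = c * pairing \<phi> p"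
  "pairing \<phi> (sum P I) = (\<Sum>i\<in>I. pairing \<phi> (P i))"
proof -
  interpret L: Vector_Spaces.linear fscale "(*)" "pairing \<phi>" by (rule linear_pairing)
  show "pairing \<phi> 0 = 0" "pairing \<phi> (p + q) = pairing \<phi> p + pairing \<phi> q"
    "pairing \<phi> (p - q) = pairing \<phi> p - pairing \<phi> q" "pairing \<phi> (fscale c p) = c * pairing \<phi> p"
    "pairing \<phi> (sum P I) = (\<Sum>i\<in>I. pairing \<phi> (P i))"
    by (simp_all only: L.zero L.add L.diff L.scale L.sum)
qed

lemma pairing_single [simp]: "pairing \<phi> (Poly_Mapping.single x 1) = \<phi> x"
  by (simp add: pairing_def)

lemma pairing_tensor2 [simp]: "pairing \<phi> (a \<otimes> b) = \<phi> (a, b)"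
  by (simp add: tensor2_def)

lemma pairing_tensor3 [simp]: "pairing \<phi> (tensor3 a b c) = \<phi> (a, b, c)"
  by (simp add: tensor3_def)

text \<open>
  Pairing with a formal sum amounts to pairing with each of its terms. This moves the Sweedler
  expressions, which are linear extensions, into the argument of the form.
\<close>

lemma pairing_linear_ext [simp]:
  "pairing \<phi> (linear_ext h p) = pairing (\<lambda>x. pairing \<phi> (h x)) p"
  by (simp add: linear_ext_def) (simp add: pairing_def)

lemma sum_fscale_single:
  "p = (\<Sum>x\<in>Poly_Mapping.keys p. fscale (Poly_Mapping.lookup p x) (Poly_Mapping.single x 1))"
  by (rule poly_mapping_eqI)
     (auto simp: lookup_sum lookup_single when_def in_keys_iff if_distrib sum.delta cong: if_cong)

lemma linear_eq_pairing:
  assumes "Vector_Spaces.linear fscale (*) g"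
  shows "g p = pairing (\<lambda>x. g (Poly_Mapping.single x 1)) p"
proof -
  interpret L: Vector_Spaces.linear fscale "(*)" g by fact
  have "g p = g (\<Sum>x\<in>Poly_Mapping.keys p.
      fscale (Poly_Mapping.lookup p x) (Poly_Mapping.single x 1))"
    by (rule arg_cong[OF sum_fscale_single])
  then show ?thesis by (simp add: L.sum L.scale pairing_def)
qed

text \<open>
  A subspace of a vector space is the intersection of the kernels of the functionals that vanish
  on it: a vector outside the span of \<open>R\<close> extends a basis of that span to an independent set, and
  a functional may be prescribed freely there.
\<close>

lemma in_span_iff_pairing:
  fixes R :: "('x \<Rightarrow>\<^sub>0 'k::field) set"
  shows "p \<in> module.span fscale R \<longleftrightarrow>
    (\<forall>\<phi>. (\<forall>r\<in>R. pairing \<phi> r = 0) \<longrightarrow> pairing \<phi> p = 0)"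
proof -
  interpret V: vector_space "fscale :: 'k \<Rightarrow> ('x \<Rightarrow>\<^sub>0 'k) \<Rightarrow> _" by (rule vector_space_fscale)
  have "vector_space ((*) :: 'k \<Rightarrow> 'k \<Rightarrow> 'k)"
    by (simp add: vector_space_def distrib_left distrib_right)
  then have pair: "vector_space_pair (fscale :: 'k \<Rightarrow> ('x \<Rightarrow>\<^sub>0 'k) \<Rightarrow> _) ((*) :: 'k \<Rightarrow> 'k \<Rightarrow> 'k)"
    by (rule vector_space_pair.intro[OF vector_space_fscale])
  have zero_on_span: "g x = 0"
    if "Vector_Spaces.linear fscale (*) g" "\<And>b. b \<in> B \<Longrightarrow> g b = 0" "x \<in> V.span B"
    for g :: "('x \<Rightarrow>\<^sub>0 'k) \<Rightarrow> 'k" and B x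
    by (rule vector_space_pair.linear_eq_0_on_span[OF pair that])
  show ?thesis
  proof (intro iffI allI impI)
    fix \<phi> assume "p \<in> V.span R" "\<forall>r\<in>R. pairing \<phi> r = 0"
    then show "pairing \<phi> p = 0"
      using zero_on_span[OF linear_pairing] by blast
  next
    assume ann: "\<forall>\<phi>. (\<forall>r\<in>R. pairing \<phi> r = 0) \<longrightarrow> pairing \<phi> p = 0"
    obtain B where B: "B \<subseteq> R" "V.independent B" "R \<subseteq> V.span B"
      using V.basis_exists[of R] by metis
    show "p \<in> V.span R"
    proof (rule ccontr)
      assume "p \<notin> V.span R"
      with B(1) have pB: "p \<notin> V.span B" using V.span_mono by blast
      then have indep: "V.independent (insert p B)" by (rule V.independent_insertI[OF _ B(2)])
      obtain g where g: "Vector_Spaces.linear fscale (*) g"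
        and gB: "\<forall>x\<in>insert p B. g x = (if x = p then 1 else 0)"
        using vector_space_pair.linear_independent_extend[OF pair indep, of "\<lambda>x. if x = p then 1 else 0"]
        by blast
      have "p \<notin> B" using pB V.span_base by blast
      then have "g b = 0" if "b \<in> B" for b using that gB by auto
      then have "g r = 0" if "r \<in> R" for r
        using zero_on_span[OF g] B(3) that by blast
      then have "g p = 0"
        using ann[rule_format, of "\<lambda>x. g (Poly_Mapping.single x 1)"]
        unfolding linear_eq_pairing[OF g, symmetric] by blast
      with gB show False by simp
    qed
  qed
qed

text \<open>
  The four clauses correspond one by one to the four families of \<open>relations2\<close>.
\<close>

definition bilinear_form :: "('k::field \<Rightarrow> 'a::ab_group_add \<Rightarrow> 'a) \<Rightarrow> ('a \<Rightarrow> 'a \<Rightarrow> 'k) \<Rightarrow> bool" where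
  "bilinear_form s \<phi> \<longleftrightarrow>
     (\<forall>a a' b. \<phi> (a + a') b = \<phi> a b + \<phi> a' b) \<and> (\<forall>a b b'. \<phi> a (b + b') = \<phi> a b + \<phi> a b') \<and>
     (\<forall>c a b. \<phi> (s c a) b = c * \<phi> a b) \<and> (\<forall>c a b. \<phi> a (s c b) = c * \<phi> a b)"

definition trilinear_form :: "('k::field \<Rightarrow> 'a::ab_group_add \<Rightarrow> 'a) \<Rightarrow> ('a \<Rightarrow> 'a \<Rightarrow> 'a \<Rightarrow> 'k) \<Rightarrow> bool" where
  "trilinear_form s \<psi> \<longleftrightarrow>
     (\<forall>c. bilinear_form s (\<lambda>a b. \<psi> a b c)) \<and> (\<forall>a. bilinear_form s (\<psi> a))"

lemma relations2_annihilated_iff: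
  "(\<forall>r\<in>relations2 s. pairing (\<lambda>(a, b). \<phi> a b) r = 0) \<longleftrightarrow> bilinear_form s \<phi>"
proof -
  have ball3: "(\<forall>r\<in>{h x y z | x y z. True}. P r) \<longleftrightarrow> (\<forall>x y z. P (h x y z))"
    for P and h :: "'x \<Rightarrow> 'y \<Rightarrow> 'z \<Rightarrow> 'r"
    by blast
  show ?thesis
    unfolding relations2_def ball_Un ball3 bilinear_form_def by (simp add: diff_diff_eq)
qed

lemma relations3_annihilated_iff:
  "(\<forall>r\<in>relations3 s. pairing (\<lambda>(a, b, c). \<psi> a b c) r = 0) \<longleftrightarrow> trilinear_form s \<psi>"
proof -
  have ball4: "(\<forall>r\<in>{h w x y z | w x y z. True}. P r) \<longleftrightarrow> (\<forall>w x y z. P (h w x y z))"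
    for P and h :: "'w \<Rightarrow> 'x \<Rightarrow> 'y \<Rightarrow> 'z \<Rightarrow> 'r"
    by blast
  show ?thesis
    unfolding relations3_def ball_Un ball4 trilinear_form_def bilinear_form_def
    by (simp add: diff_diff_eq, intro iffI conjI allI; elim conjE; simp)
qed

section \<open>Equality of tensors and Sweedler notation\<close>

text \<open>
  A functional on formal sums of pairs kills the relations of the tensor square exactly when it
  comes from a bilinear form, so the separation of points takes this form.
\<close>

lemma class2_eq_iff_pairing:
  fixes s :: "'k::field \<Rightarrow> 'a::ab_group_add \<Rightarrow> 'a"
  shows "class2 s p = class2 s q \<longleftrightarrow>
     (\<forall>\<phi>. bilinear_form s \<phi> \<longrightarrow> pairing (\<lambda>(a, b). \<phi> a b) p = pairing (\<lambda>(a, b). \<phi> a b) q)"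
proof -
  have all_curried: "(\<forall>\<phi>. P \<phi>) \<longleftrightarrow> (\<forall>\<phi>. P (\<lambda>(a, b). \<phi> a b))" for P :: "('a \<times> 'a \<Rightarrow> 'k) \<Rightarrow> bool"
    by (metis case_prod_curry)
  show ?thesis
    unfolding class2_eq_iff in_span_iff_pairing
    by (subst all_curried) (simp only: relations2_annihilated_iff pairing_simps right_minus_eq)
qed

lemma class3_eq_iff_pairing:
  fixes s :: "'k::field \<Rightarrow> 'a::ab_group_add \<Rightarrow> 'a"
  shows "class3 s p = class3 s q \<longleftrightarrow>
     (\<forall>\<psi>. trilinear_form s \<psi> \<longrightarrow>
        pairing (\<lambda>(a, b, c). \<psi> a b c) p = pairing (\<lambda>(a, b, c). \<psi> a b c) q)"
proof -
  have all_curried: "(\<forall>\<phi>. P \<phi>) \<longleftrightarrow> (\<forall>\<psi>. P (\<lambda>(a, b, c). \<psi> a b c))"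
    for P :: "('a \<times> 'a \<times> 'a \<Rightarrow> 'k) \<Rightarrow> bool"
  proof (intro iffI allI)
    fix \<phi> assume "\<forall>\<psi>. P (\<lambda>(a, b, c). \<psi> a b c)"
    then have "P (\<lambda>(a, b, c). \<phi> (a, b, c))" by (rule spec)
    then show "P \<phi>" by simp
  qed blast
  show ?thesis
    unfolding class3_eq_iff in_span_iff_pairing
    by (subst all_curried) (simp only: relations3_annihilated_iff pairing_simps right_minus_eq)
qed

text \<open>
  The value of a tensor under the functional on \<open>A \<otimes> A\<close> induced by \<open>\<phi>\<close>, that is,
  \<open>\<Sum>\<^sub>i \<phi>(a\<^sub>i, b\<^sub>i)\<close> for \<open>T = \<Sum>\<^sub>i a\<^sub>i \<otimes> b\<^sub>i\<close>. It is taken on the chosen representative, which is harmless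
  for bilinear \<open>\<phi>\<close> by \<open>contract_class2\<close>.
\<close>

definition contract :: "('a \<times> 'a \<Rightarrow>\<^sub>0 'k::field) set \<Rightarrow> ('a \<Rightarrow> 'a \<Rightarrow> 'k) \<Rightarrow> 'k" where
  "contract T \<phi> = pairing (\<lambda>(a, b). \<phi> a b) (rep T)"

lemma pairing_sweedler [simp]:
  "pairing \<phi> (sweedler T h) = contract T (\<lambda>a b. pairing \<phi> (h a b))"
  by (simp add: sweedler_def contract_def case_prod_unfold)

lemma pairing_rep: "pairing (\<lambda>(a, b). \<phi> a b) (rep T) = contract T \<phi>"
  by (simp add: contract_def)

lemma pairing_flip [simp]:
  "pairing (\<lambda>(a, b). \<phi> a b) (flip p) = pairing (\<lambda>(a, b). \<phi> b a) p"
  by (simp add: flip_def case_prod_unfold)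

lemma contract_simps:
  "contract T (\<lambda>a b. \<phi> a b + \<chi> a b) = contract T \<phi> + contract T \<chi>"
  "contract T (\<lambda>a b. \<phi> a b - \<chi> a b) = contract T \<phi> - contract T \<chi>"
  "contract T (\<lambda>a b. - \<phi> a b) = - contract T \<phi>"
  "contract T (\<lambda>a b. c * \<phi> a b) = c * contract T \<phi>"
  by (simp_all add: contract_def pairing_def case_prod_unfold algebra_simps sum.distrib
      sum_subtractf sum_negf sum_distrib_left)

text \<open>
  The contraction of a tensor with a bilinear form may be computed on any representative.
\<close>

lemma contract_class2:
  fixes s :: "'k::field \<Rightarrow> 'a::ab_group_add \<Rightarrow> 'a"
  assumes "bilinear_form s \<phi>"
  shows "contract (class2 s p) \<phi> = pairing (\<lambda>(a, b). \<phi> a b) p"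
proof -
  interpret V: vector_space "fscale :: 'k \<Rightarrow> ('a \<times> 'a \<Rightarrow>\<^sub>0 'k) \<Rightarrow> _" by (rule vector_space_fscale)
  have "p \<in> class2 s p" by (simp add: class2_def V.span_zero)
  then have "rep (class2 s p) \<in> class2 s p" unfolding rep_def by (rule someI)
  then have "class2 s (rep (class2 s p)) = class2 s p"
    by (simp add: class2_eq_iff) (simp add: class2_def)
  with assms show ?thesis by (simp add: class2_eq_iff_pairing contract_def)
qed

section \<open>The special bracket\<close>

lemma linear_simps:
  assumes "Vector_Spaces.linear s t h"
  shows "h (x + y) = h x + h y" "h (s c x) = t c (h x)" "h (x - y) = h x - h y"
proof -
  interpret Vector_Spaces.linear s t h by fact
  show "h (x + y) = h x + h y" "h (s c x) = t c (h x)" "h (x - y) = h x - h y"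
    by (simp_all add: add scale diff)
qed

lemma linear_plus:
  assumes "Vector_Spaces.linear s t h" "Vector_Spaces.linear s t k"
  shows "Vector_Spaces.linear s t (\<lambda>x. h x + k x)"
  using vector_space_pair.linear_compose_add[OF _ assms] assms
  by (simp add: vector_space_pair_def Vector_Spaces.linear_def)

lemma linear_comp:
  assumes "Vector_Spaces.linear s t h" "Vector_Spaces.linear t u k"
  shows "Vector_Spaces.linear s u (\<lambda>x. k (h x))"
  using Vector_Spaces.linear_compose[OF assms] by (simp add: o_def)

locale special_algebra =
  fixes s :: "'k::field \<Rightarrow> 'a::ab_group_add \<Rightarrow> 'a"
    and m :: "'a \<Rightarrow> 'a \<Rightarrow> 'a" and f g :: "'a \<Rightarrow> 'a"
  assumes comm_assoc: "comm_assoc_algebra s m"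
    and linear_f: "Vector_Spaces.linear s s f" and linear_g: "Vector_Spaces.linear s s g"
begin

abbreviation bracket where "bracket \<equiv> special_bracket m f g"

lemma bilinear_m: "bilinear_op s m" and m_commute: "m x y = m y x"
  and m_assoc: "m (m x y) z = m x (m y z)"
  using comm_assoc by (auto simp: comm_assoc_algebra_def)

lemma m_left_commute: "m x (m y z) = m y (m x z)"
  by (metis m_assoc m_commute)

lemma linear_m_right: "Vector_Spaces.linear s s (\<lambda>y. m x y)"
  and linear_m_left: "Vector_Spaces.linear s s (\<lambda>x. m x y)"
  using bilinear_m by (auto simp: bilinear_op_def)

lemmas linearity =
  linear_simps[OF linear_f] linear_simps[OF linear_g]
  linear_simps[OF linear_m_right] linear_simps[OF linear_m_left]

lemma bilinear_bracket: "bilinear_op s bracket"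
  unfolding bilinear_op_def special_bracket_def
  by (intro conjI allI linear_plus linear_m_left linear_comp[OF linear_f linear_m_right]
      linear_comp[OF linear_m_left linear_g] linear_comp[OF linear_m_right linear_g])

lemma bracket_commutator: "bracket x y - bracket y x = m x (f y) - m y (f x)"
  by (simp add: special_bracket_def m_commute)

text \<open>
  Subtracting the two sides of the left Alia identity leaves the cyclic sum of the brackets of the
  commutators with the third variable. Both in the \<open>f\<close>-part, a product of \<open>x\<close>, \<open>y\<close>, \<open>z\<close> with \<open>f\<close>
  applied to two of them, and in the \<open>g\<close>-part, with \<open>f\<close> applied to one of them under \<open>g\<close>, each
  product occurs once with either sign.
\<close>

lemma left_alia_algebra_bracket: "left_alia_algebra s bracket"
proof -
  have "bracket (bracket x y) z + bracket (bracket y z) x + bracket (bracket z x) y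
      = bracket (bracket y x) z + bracket (bracket z y) x + bracket (bracket x z) y" for x y z
  proof -
    let ?c = "\<lambda>x y. m x (f y) - m y (f x)"
    have diff: "bracket (bracket x y) z - bracket (bracket y x) z = bracket (?c x y) z" for x y z
    proof -
      have "Vector_Spaces.linear s s (\<lambda>u. bracket u z)"
        using bilinear_bracket by (simp add: bilinear_op_def)
      from linear_simps(3)[OF this, of "bracket x y" "bracket y x"]
      show ?thesis by (simp add: bracket_commutator)
    qed
    have "bracket (?c x y) z + bracket (?c y z) x + bracket (?c z x) y = 0"
      by (simp add: special_bracket_def linearity m_assoc m_commute m_left_commute algebra_simps)
    then show ?thesis unfolding diff[symmetric] by (simp add: algebra_simps)
  qed
  with bilinear_bracket show ?thesis unfolding left_alia_algebra_def by blast
qed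

text \<open>
  The summand \<open>m x (f y)\<close> is covered by the Nijenhuis identity of \<open>m\<close> at \<open>x\<close> and \<open>f y\<close>, and the
  summand \<open>g (m x y)\<close> by \<open>g\<close> applied to that identity at \<open>x\<close> and \<open>y\<close>.
\<close>

lemma nijenhuis_operator_bracket:
  assumes "nijenhuis_operator s m f" and "\<And>x. g (f x) = f (g x)"
  shows "nijenhuis_operator s bracket f"
proof -
  have nij: "m (f x) (f y) + f (f (m x y)) = f (m (f x) y) + f (m x (f y))" for x y
    using assms(1) by (simp add: nijenhuis_operator_def linearity)
  have "bracket (f x) (f y) + f (f (bracket x y)) = f (bracket (f x) y + bracket x (f y))" for x y
    using nij[of x "f y"] arg_cong[OF nij[of x y], of g]
    by (simp add: special_bracket_def linearity assms(2) algebra_simps)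
  with linear_f show ?thesis by (simp add: nijenhuis_operator_def)
qed

text \<open>
  The same two instances of the condition on \<open>m\<close> give the first identity. The second one starts
  from the mirrored condition, which commutativity of \<open>m\<close> supplies.
\<close>

lemma bracket_admissible:
  assumes F: "Vector_Spaces.linear s s F"
    and comm: "\<And>x. F (f x) = f (F x)" "\<And>x. g (F x) = F (g x)"
    and adm: "\<And>x y. F (m (f x) y) + m x (F (F y)) = m (f x) (F y) + F (m x (F y))"
  shows "F (bracket (f x) y) + bracket x (F (F y)) = F (bracket x (F y)) + bracket (f x) (F y)"
    and "F (bracket x (f y)) + bracket (F (F x)) y = F (bracket (F x) y) + bracket (F x) (f y)"
proof -
  note lin = linearity linear_simps[OF F] special_bracket_def comm
  show "F (bracket (f x) y) + bracket x (F (F y)) = F (bracket x (F y)) + bracket (f x) (F y)"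
    using adm[of x "f y"] arg_cong[OF adm[of x y], of g]
    by (simp add: lin algebra_simps)
  have adm': "F (m x (f y)) + m (F (F x)) y = m (F x) (f y) + F (m (F x) y)" for x y
    using adm[of y x] by (simp add: m_commute)
  show "F (bracket x (f y)) + bracket (F (F x)) y = F (bracket (F x) y) + bracket (F x) (f y)"
    using adm'[of x "f y"] arg_cong[OF adm'[of x y], of g]
    by (simp add: lin algebra_simps)
qed

end

section \<open>The special comultiplication\<close>

locale special_coalgebra =
  fixes s :: "'k::field \<Rightarrow> 'a::ab_group_add \<Rightarrow> 'a"
    and \<delta> :: "'a \<Rightarrow> ('a \<times> 'a \<Rightarrow>\<^sub>0 'k) set" and F G :: "'a \<Rightarrow> 'a"
  assumes cocomm_coassoc: "cocomm_coassoc_coalgebra s \<delta>"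
    and linear_F: "Vector_Spaces.linear s s F" and linear_G: "Vector_Spaces.linear s s G"
begin

abbreviation \<Delta> where "\<Delta> \<equiv> special_comultiplication s \<delta> F G"

lemmas linearity = linear_simps[OF linear_F] linear_simps[OF linear_G]

lemma contract_add:
  assumes "bilinear_form s \<phi>"
  shows "contract (\<delta> (x + y)) \<phi> = contract (\<delta> x) \<phi> + contract (\<delta> y) \<phi>"
proof -
  have "\<delta> (x + y) = class2 s (rep (\<delta> x) + rep (\<delta> y))"
    using cocomm_coassoc by (simp add: cocomm_coassoc_coalgebra_def comultiplication_def)
  then show ?thesis by (simp add: contract_class2[OF assms] pairing_rep)
qed

lemma contract_scale:
  assumes "bilinear_form s \<phi>"
  shows "contract (\<delta> (s c x)) \<phi> = c * contract (\<delta> x) \<phi>"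
proof -
  have "\<delta> (s c x) = class2 s (fscale c (rep (\<delta> x)))"
    using cocomm_coassoc by (simp add: cocomm_coassoc_coalgebra_def comultiplication_def)
  then show ?thesis by (simp add: contract_class2[OF assms] pairing_rep)
qed

lemma contract_diff:
  assumes "bilinear_form s \<phi>"
  shows "contract (\<delta> (x - y)) \<phi> = contract (\<delta> x) \<phi> - contract (\<delta> y) \<phi>"
  using contract_add[OF assms, of "x - y" y] by simp

lemma contract_swap:
  assumes "bilinear_form s \<phi>"
  shows "contract (\<delta> x) (\<lambda>a b. \<phi> b a) = contract (\<delta> x) \<phi>"
proof -
  have "contract (\<delta> x) \<phi> = contract (class2 s (sweedler (\<delta> x) (\<lambda>x1 x2. x2 \<otimes> x1))) \<phi>"
    using cocomm_coassoc by (simp add: cocomm_coassoc_coalgebra_def)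
  then show ?thesis by (simp add: contract_class2[OF assms])
qed

lemma contract_coassoc:
  assumes "trilinear_form s \<psi>"
  shows "contract (\<delta> x) (\<lambda>a b. contract (\<delta> a) (\<lambda>c d. \<psi> c d b))
       = contract (\<delta> x) (\<lambda>a b. contract (\<delta> b) (\<lambda>c d. \<psi> a c d))"
proof -
  have "class3 s (sweedler (\<delta> x) (\<lambda>x1 x2. sweedler (\<delta> x1) (\<lambda>x11 x12. tensor3 x11 x12 x2)))
      = class3 s (sweedler (\<delta> x) (\<lambda>x1 x2. sweedler (\<delta> x2) (\<lambda>x21 x22. tensor3 x1 x21 x22)))"
    using cocomm_coassoc by (simp add: cocomm_coassoc_coalgebra_def)
  with assms show ?thesis by (simp add: class3_eq_iff_pairing)
qed

text \<open>
  Every condition on \<open>\<Delta>\<close>, tested against a form, is reduced by this formula to one on \<open>\<delta>\<close>.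
\<close>

lemma contract_special:
  assumes "bilinear_form s \<phi>"
  shows "contract (\<Delta> x) \<phi> = contract (\<delta> x) (\<lambda>a b. \<phi> a (F b)) + contract (\<delta> (G x)) \<phi>"
  by (simp add: special_comultiplication_def contract_class2[OF assms])

lemma bilinear_form_F:
  assumes "bilinear_form s \<phi>"
  shows "bilinear_form s (\<lambda>a b. \<phi> a (F b))"
  using assms by (simp add: bilinear_form_def linearity)

lemma comultiplication_special: "comultiplication s \<Delta>"
  unfolding comultiplication_def
proof (intro conjI allI)
  fix x y c
  show "\<Delta> x \<in> tensor_square s" by (simp add: special_comultiplication_def tensor_square_def)
  show "\<Delta> (x + y) = class2 s (rep (\<Delta> x) + rep (\<Delta> y))"
    unfolding special_comultiplication_def[of s \<delta> F G "x + y"] class2_eq_iff_pairing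
    by (simp add: pairing_rep contract_special contract_add bilinear_form_F linearity)
  show "\<Delta> (s c x) = class2 s (fscale c (rep (\<Delta> x)))"
    unfolding special_comultiplication_def[of s \<delta> F G "s c x"] class2_eq_iff_pairing
    by (simp add: pairing_rep contract_special contract_scale bilinear_form_F linearity
        distrib_left)
qed

text \<open>
  Contracting two arguments of a trilinear form with \<open>\<delta>\<close> leaves a bilinear form, so that the outer
  factor of an iterated contraction may in turn be treated by the rules for bilinear forms.
\<close>

lemma bilinear_form_contract:
  assumes "trilinear_form s \<psi>"
  shows "bilinear_form s (\<lambda>a b. contract (\<delta> a) (\<lambda>c d. \<psi> c d b))"
proof -
  have bil: "bilinear_form s (\<lambda>c d. \<psi> c d b)" for b
    using assms by (simp add: trilinear_form_def)
  have "\<psi> c d (b + b') = \<psi> c d b + \<psi> c d b'" "\<psi> c d (s k b) = k * \<psi> c d b" for c d b b' k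
    using assms by (simp_all add: trilinear_form_def bilinear_form_def)
  then show ?thesis
    unfolding bilinear_form_def by (simp add: contract_add[OF bil] contract_scale[OF bil] contract_simps)
qed

text \<open>
  The contraction of \<open>(\<delta> \<otimes> id) (\<delta> x)\<close> with a trilinear form.
\<close>

definition contract3 :: "'a \<Rightarrow> ('a \<Rightarrow> 'a \<Rightarrow> 'a \<Rightarrow> 'k) \<Rightarrow> 'k" where
  "contract3 x \<psi> = contract (\<delta> x) (\<lambda>a b. contract (\<delta> a) (\<lambda>c d. \<psi> c d b))"

lemma contract3_swap:
  assumes "trilinear_form s \<psi>"
  shows "contract3 x (\<lambda>a b c. \<psi> b a c) = contract3 x \<psi>"
  unfolding contract3_def
  using contract_swap[of "\<lambda>a b. \<psi> a b _"] assms by (simp add: trilinear_form_def)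

text \<open>
  Coassociativity moves the inner comultiplication to the right factor, and cocommutativity of
  the outer one then brings it back to the left; the net effect is a cyclic shift. Together with
  \<open>contract3_swap\<close> this gives invariance under all permutations of the three factors.
\<close>

lemma contract3_rotate:
  assumes "trilinear_form s \<psi>"
  shows "contract3 x (\<lambda>a b c. \<psi> c a b) = contract3 x \<psi>"
proof -
  have rotated: "trilinear_form s (\<lambda>a b c. \<psi> c a b)"
    using assms by (simp add: trilinear_form_def bilinear_form_def)
  have "contract3 x \<psi> = contract (\<delta> x) (\<lambda>b a. contract (\<delta> a) (\<lambda>c d. \<psi> b c d))"
    unfolding contract3_def by (rule contract_coassoc[OF assms])
  also have "\<dots> = contract3 x (\<lambda>a b c. \<psi> c a b)"
    unfolding contract3_def by (rule contract_swap[OF bilinear_form_contract[OF rotated]])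
  finally show ?thesis ..
qed

text \<open>
  The iterated comultiplication is fixed by the transposition under which the form changes sign,
  so the contraction equals its own negative.
\<close>

lemma contract3_eq_0_if_antisymmetric:
  assumes \<psi>: "trilinear_form s \<psi>" and char: "(2 :: 'k) \<noteq> 0"
    and anti: "(\<forall>a b c. \<psi> a c b = - \<psi> a b c) \<or> (\<forall>a b c. \<psi> c b a = - \<psi> a b c)"
  shows "contract3 x \<psi> = 0"
proof -
  have swapped: "trilinear_form s (\<lambda>a b c. \<psi> b a c)" and rotated: "trilinear_form s (\<lambda>a b c. \<psi> c a b)"
    using \<psi> by (simp_all add: trilinear_form_def bilinear_form_def)
  \<comment> \<open>These two transpositions are composed from \<open>contract3_swap\<close> and \<open>contract3_rotate\<close>.\<close>
  have "contract3 x (\<lambda>a b c. \<psi> a c b) = contract3 x \<psi>"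
    using contract3_rotate[OF swapped] contract3_swap[OF \<psi>] by simp
  moreover have "contract3 x (\<lambda>a b c. \<psi> c b a) = contract3 x \<psi>"
    using contract3_swap[OF rotated] contract3_rotate[OF \<psi>] by simp
  moreover have "(\<lambda>a b c. \<psi> a c b) = (\<lambda>a b c. - \<psi> a b c) \<or> (\<lambda>a b c. \<psi> c b a) = (\<lambda>a b c. - \<psi> a b c)"
    using anti by (auto intro!: ext)
  ultimately have "contract3 x (\<lambda>a b c. - \<psi> a b c) = contract3 x \<psi>"
    by metis
  then have "- contract3 x \<psi> = contract3 x \<psi>"
    by (simp add: contract3_def contract_simps)
  then have "2 * contract3 x \<psi> = 0" by (simp only: neg_eq_iff_add_eq_0 mult_2)
  with char show ?thesis by simp
qed

text \<open>
  The difference of the two sides of the left Alia identity, tested against \<open>\<psi>\<close>, is the contraction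
  of \<open>(\<Delta> \<otimes> id) (\<Delta> x)\<close> with the antisymmetrisation \<open>\<chi>\<close> of \<open>\<psi>\<close>. On the inner \<open>\<Delta>\<close> the summand \<open>\<delta> G\<close> is
  symmetric and contributes nothing. On the outer \<open>\<Delta>\<close> both summands contribute a contraction of
  the iterated \<open>\<delta>\<close>: \<open>\<chi> a (F b) (F c)\<close> is antisymmetric in \<open>b\<close> and \<open>c\<close>, and \<open>\<chi> a (F b) c\<close> in \<open>a\<close> and \<open>c\<close>.
\<close>

lemma left_alia_coalgebra_special:
  assumes char: "(2 :: 'k) \<noteq> 0"
  shows "left_alia_coalgebra s \<Delta>"
proof -
  have vanish: "contract (\<Delta> x) (\<lambda>a b. contract (\<Delta> a) (\<lambda>c d. \<chi> c d b)) = 0"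
    if \<chi>: "trilinear_form s \<chi>" and anti12: "\<And>a b c. \<chi> b a c = - \<chi> a b c"
      and anti23: "\<And>a b c. \<chi> a c b = - \<chi> a b c" for x \<chi>
  proof -
    have anti13: "\<chi> c b a = - \<chi> a b c" for a b c
      using anti12[of c b a] anti23[of b a c] anti12[of a b c] by simp
    have bil: "bilinear_form s (\<lambda>a b. \<chi> a b c)" for c using \<chi> by (simp add: trilinear_form_def)
    have \<chi>1: "trilinear_form s (\<lambda>a b c. \<chi> a (F b) (F c))"
      and \<chi>2: "trilinear_form s (\<lambda>a b c. \<chi> a (F b) c)"
      using \<chi> by (simp_all add: trilinear_form_def bilinear_form_def linearity)
    have inner: "contract (\<Delta> a) (\<lambda>c d. \<chi> c d b) = contract (\<delta> a) (\<lambda>c d. \<chi> c (F d) b)" for a b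
    proof -
      have "contract (\<delta> (G a)) (\<lambda>c d. \<chi> d c b) = - contract (\<delta> (G a)) (\<lambda>c d. \<chi> c d b)"
        by (rule trans[OF arg_cong[where f = "contract (\<delta> (G a))"] contract_simps(3)])
          (intro ext anti12)
      then have "contract (\<delta> (G a)) (\<lambda>c d. \<chi> c d b) = - contract (\<delta> (G a)) (\<lambda>c d. \<chi> c d b)"
        unfolding contract_swap[OF bil] .
      then have "2 * contract (\<delta> (G a)) (\<lambda>c d. \<chi> c d b) = 0"
        by (simp only: eq_neg_iff_add_eq_0 mult_2)
      with char show ?thesis by (simp add: contract_special[OF bil])
    qed
    have "contract (\<Delta> x) (\<lambda>a b. contract (\<Delta> a) (\<lambda>c d. \<chi> c d b))
        = contract3 x (\<lambda>a b c. \<chi> a (F b) (F c)) + contract3 (G x) (\<lambda>a b c. \<chi> a (F b) c)"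
      by (simp add: inner contract_special[OF bilinear_form_contract[OF \<chi>2]] contract3_def)
    also have "contract3 x (\<lambda>a b c. \<chi> a (F b) (F c)) = 0"
      using anti23 by (intro contract3_eq_0_if_antisymmetric[OF \<chi>1 char]) blast
    also have "contract3 (G x) (\<lambda>a b c. \<chi> a (F b) c) = 0"
      using anti13 by (intro contract3_eq_0_if_antisymmetric[OF \<chi>2 char]) blast
    finally show ?thesis by simp
  qed
  show ?thesis
    unfolding left_alia_coalgebra_def class3_eq_iff_pairing
  proof (intro conjI allI impI comultiplication_special)
    fix x \<psi> assume \<psi>: "trilinear_form s \<psi>"
    \<comment> \<open>The odd minus the even permutations, as they occur on the two sides of the identity.\<close>
    let ?\<chi> = "\<lambda>a b c. (\<psi> b a c + \<psi> a c b + \<psi> c b a) - (\<psi> a b c + \<psi> b c a + \<psi> c a b)"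
    have "trilinear_form s ?\<chi>"
      using \<psi> by (simp add: trilinear_form_def bilinear_form_def algebra_simps)
    then have "contract (\<Delta> x) (\<lambda>a b. contract (\<Delta> a) (\<lambda>c d. ?\<chi> c d b)) = 0"
      by (rule vanish) (simp_all add: algebra_simps)
    then show "pairing (\<lambda>(a, b, c). \<psi> a b c)
          (sweedler (\<Delta> x) (\<lambda>x1 x2. sweedler (\<Delta> x1) (\<lambda>x11 x12.
              tensor3 x12 x11 x2 + tensor3 x11 x2 x12 + tensor3 x2 x12 x11)))
        = pairing (\<lambda>(a, b, c). \<psi> a b c)
          (sweedler (\<Delta> x) (\<lambda>x1 x2. sweedler (\<Delta> x1) (\<lambda>x11 x12.
              tensor3 x11 x12 x2 + tensor3 x12 x2 x11 + tensor3 x2 x11 x12)))"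
      by (simp add: contract_simps)
  qed
qed

lemma contract_nijenhuis:
  assumes "nijenhuis_cooperator s \<delta> S" "bilinear_form s \<phi>"
  shows "contract (\<delta> x) (\<lambda>a b. \<phi> (S a) (S b)) + contract (\<delta> (S (S x))) \<phi>
    = contract (\<delta> (S x)) (\<lambda>a b. \<phi> (S a) b) + contract (\<delta> (S x)) (\<lambda>a b. \<phi> a (S b))"
  using assms by (simp add: nijenhuis_cooperator_def class2_eq_iff_pairing)

text \<open>
  Of the two instances of the identity for \<open>\<delta>\<close>, the one at \<open>G x\<close> covers the summand \<open>\<delta> G\<close>, and the one at
  \<open>x\<close> for the form \<open>\<phi> a (F b)\<close> covers the summand \<open>(id \<otimes> F) \<delta>\<close>.
\<close>

lemma nijenhuis_cooperator_special:
  assumes nij: "nijenhuis_cooperator s \<delta> F" and comm: "\<And>x. G (F x) = F (G x)"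
  shows "nijenhuis_cooperator s \<Delta> F"
  unfolding nijenhuis_cooperator_def class2_eq_iff_pairing
proof (intro conjI allI impI linear_F)
  fix x \<phi> assume \<phi>: "bilinear_form s \<phi>"
  then have bil: "bilinear_form s (\<lambda>a b. \<phi> (F a) (F b))" "bilinear_form s (\<lambda>a b. \<phi> (F a) b)"
    "bilinear_form s (\<lambda>a b. \<phi> a (F b))"
    by (simp_all add: bilinear_form_def linearity)
  show "pairing (\<lambda>(a, b). \<phi> a b) (sweedler (\<Delta> x) (\<lambda>x1 x2. F x1 \<otimes> F x2)
                    + sweedler (\<Delta> (F (F x))) (\<lambda>z1 z2. z1 \<otimes> z2))
      = pairing (\<lambda>(a, b). \<phi> a b) (sweedler (\<Delta> (F x)) (\<lambda>z1 z2. F z1 \<otimes> z2)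
                    + sweedler (\<Delta> (F x)) (\<lambda>z1 z2. z1 \<otimes> F z2))"
    using arg_cong2[where f = "(+)", OF contract_nijenhuis[OF nij \<phi>, of "G x"]
        contract_nijenhuis[OF nij bil(3), of x]]
    by (simp add: contract_special \<phi> bil comm ac_simps)
qed

text \<open>
  The same two instances of the condition on \<open>\<delta>\<close> give the first identity. For the second one the
  condition is first mirrored, by cocommutativity of \<open>\<delta>\<close>.
\<close>

lemma coadmissible_special:
  assumes f: "Vector_Spaces.linear s s f"
    and comm: "\<And>x. F (f x) = f (F x)" "\<And>x. G (f x) = f (G x)"
    and adm: "\<And>x. class2 s (sweedler (\<delta> (f x)) (\<lambda>z1 z2. F z1 \<otimes> z2)
                    + sweedler (\<delta> x) (\<lambda>x1 x2. x1 \<otimes> f (f x2)))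
        = class2 s (sweedler (\<delta> x) (\<lambda>x1 x2. F x1 \<otimes> f x2)
                    + sweedler (\<delta> (f x)) (\<lambda>z1 z2. z1 \<otimes> f z2))"
  shows "class2 s (sweedler (\<Delta> (f x)) (\<lambda>z1 z2. F z1 \<otimes> z2)
                    + sweedler (\<Delta> x) (\<lambda>x1 x2. x1 \<otimes> f (f x2)))
        = class2 s (sweedler (\<Delta> x) (\<lambda>x1 x2. F x1 \<otimes> f x2)
                    + sweedler (\<Delta> (f x)) (\<lambda>z1 z2. z1 \<otimes> f z2))"
    and "class2 s (sweedler (\<Delta> (f x)) (\<lambda>z1 z2. z1 \<otimes> F z2)
                    + sweedler (\<Delta> x) (\<lambda>x1 x2. f (f x1) \<otimes> x2))
        = class2 s (sweedler (\<Delta> x) (\<lambda>x1 x2. f x1 \<otimes> F x2)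
                    + sweedler (\<Delta> (f x)) (\<lambda>z1 z2. f z1 \<otimes> z2))"
proof -
  note lin = linearity linear_simps[OF f]
  have adm_left: "contract (\<delta> (f x)) (\<lambda>a b. \<phi> (F a) b) + contract (\<delta> x) (\<lambda>a b. \<phi> a (f (f b)))
      = contract (\<delta> x) (\<lambda>a b. \<phi> (F a) (f b)) + contract (\<delta> (f x)) (\<lambda>a b. \<phi> a (f b))"
    if "bilinear_form s \<phi>" for x \<phi>
    using adm[of x] that by (simp add: class2_eq_iff_pairing)
  have adm_right: "contract (\<delta> (f x)) (\<lambda>a b. \<phi> a (F b)) + contract (\<delta> x) (\<lambda>a b. \<phi> (f (f a)) b)
      = contract (\<delta> x) (\<lambda>a b. \<phi> (f a) (F b)) + contract (\<delta> (f x)) (\<lambda>a b. \<phi> (f a) b)"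
    if \<phi>: "bilinear_form s \<phi>" for x \<phi>
  proof -
    have bil: "bilinear_form s (\<lambda>a b. \<phi> b a)" "bilinear_form s (\<lambda>a b. \<phi> a (F b))"
      "bilinear_form s (\<lambda>a b. \<phi> (f (f a)) b)" "bilinear_form s (\<lambda>a b. \<phi> (f a) (F b))"
      "bilinear_form s (\<lambda>a b. \<phi> (f a) b)"
      using \<phi> by (simp_all add: bilinear_form_def lin)
    show ?thesis
      using adm_left[OF bil(1), of x] by (simp add: bil(2-)[THEN contract_swap])
  qed
  have bil: "bilinear_form s (\<lambda>a b. \<phi> a (F b))" "bilinear_form s (\<lambda>a b. \<phi> (F a) b)"
      "bilinear_form s (\<lambda>a b. \<phi> a (f (f b)))" "bilinear_form s (\<lambda>a b. \<phi> (f (f a)) b)"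
      "bilinear_form s (\<lambda>a b. \<phi> (f a) (F b))" "bilinear_form s (\<lambda>a b. \<phi> (F a) (f b))"
      "bilinear_form s (\<lambda>a b. \<phi> (f a) b)" "bilinear_form s (\<lambda>a b. \<phi> a (f b))"
    if "bilinear_form s \<phi>" for \<phi>
    using that by (simp_all add: bilinear_form_def lin)
  show "class2 s (sweedler (\<Delta> (f x)) (\<lambda>z1 z2. F z1 \<otimes> z2)
                    + sweedler (\<Delta> x) (\<lambda>x1 x2. x1 \<otimes> f (f x2)))
        = class2 s (sweedler (\<Delta> x) (\<lambda>x1 x2. F x1 \<otimes> f x2)
                    + sweedler (\<Delta> (f x)) (\<lambda>z1 z2. z1 \<otimes> f z2))"
    unfolding class2_eq_iff_pairing
  proof (intro allI impI)
    fix \<phi> assume \<phi>: "bilinear_form s \<phi>"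
    show "pairing (\<lambda>(a, b). \<phi> a b) (sweedler (\<Delta> (f x)) (\<lambda>z1 z2. F z1 \<otimes> z2)
                    + sweedler (\<Delta> x) (\<lambda>x1 x2. x1 \<otimes> f (f x2)))
        = pairing (\<lambda>(a, b). \<phi> a b) (sweedler (\<Delta> x) (\<lambda>x1 x2. F x1 \<otimes> f x2)
                    + sweedler (\<Delta> (f x)) (\<lambda>z1 z2. z1 \<otimes> f z2))"
      using arg_cong2[where f = "(+)", OF adm_left[OF \<phi>, of "G x"]
        adm_left[OF bil(1)[OF \<phi>], of x]]
      by (simp add: contract_special \<phi> bil comm ac_simps)
  qed
  show "class2 s (sweedler (\<Delta> (f x)) (\<lambda>z1 z2. z1 \<otimes> F z2)
                    + sweedler (\<Delta> x) (\<lambda>x1 x2. f (f x1) \<otimes> x2))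
        = class2 s (sweedler (\<Delta> x) (\<lambda>x1 x2. f x1 \<otimes> F x2)
                    + sweedler (\<Delta> (f x)) (\<lambda>z1 z2. f z1 \<otimes> z2))"
    unfolding class2_eq_iff_pairing
  proof (intro allI impI)
    fix \<phi> assume \<phi>: "bilinear_form s \<phi>"
    show "pairing (\<lambda>(a, b). \<phi> a b) (sweedler (\<Delta> (f x)) (\<lambda>z1 z2. z1 \<otimes> F z2)
                    + sweedler (\<Delta> x) (\<lambda>x1 x2. f (f x1) \<otimes> x2))
        = pairing (\<lambda>(a, b). \<phi> a b) (sweedler (\<Delta> x) (\<lambda>x1 x2. f x1 \<otimes> F x2)
                    + sweedler (\<Delta> (f x)) (\<lambda>z1 z2. f z1 \<otimes> z2))"
      using arg_cong2[where f = "(+)", OF adm_right[OF \<phi>, of "G x"]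
        adm_right[OF bil(1)[OF \<phi>], of x]]
      by (simp add: contract_special \<phi> bil comm ac_simps)
  qed
qed

end

section \<open>Compatibility of bracket and comultiplication\<close>

locale special_bialgebra =
  fixes s :: "'k::field \<Rightarrow> 'a::ab_group_add \<Rightarrow> 'a"
    and m :: "'a \<Rightarrow> 'a \<Rightarrow> 'a" and \<delta> :: "'a \<Rightarrow> ('a \<times> 'a \<Rightarrow>\<^sub>0 'k) set" and f g F G :: "'a \<Rightarrow> 'a"
  assumes bialgebra: "assoc_D_bialgebra s m \<delta>"
    and linear: "Vector_Spaces.linear s s f" "Vector_Spaces.linear s s g"
      "Vector_Spaces.linear s s F" "Vector_Spaces.linear s s G"

sublocale special_bialgebra \<subseteq> special_algebra s m f g
  using bialgebra linear by (simp add: special_algebra_def assoc_D_bialgebra_def)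

sublocale special_bialgebra \<subseteq> coalg: special_coalgebra s \<delta> F G
  using bialgebra linear by (simp add: special_coalgebra_def assoc_D_bialgebra_def)

context special_bialgebra
begin

lemma contract_mult:
  assumes "bilinear_form s \<phi>"
  shows "contract (\<delta> (m a b)) \<phi>
    = contract (\<delta> a) (\<lambda>a1 a2. \<phi> (m a1 b) a2) + contract (\<delta> b) (\<lambda>b1 b2. \<phi> b1 (m a b2))"
proof -
  have "\<delta> (m a b) = class2 s (sweedler (\<delta> a) (\<lambda>a1 a2. m a1 b \<otimes> a2)
                               + sweedler (\<delta> b) (\<lambda>b1 b2. b1 \<otimes> m a b2))"
    using bialgebra by (simp add: assoc_D_bialgebra_def)
  then show ?thesis by (simp add: contract_class2[OF assms])
qed

text \<open>
  The \<open>\<delta> G\<close> part of \<open>\<Delta>\<close> is symmetric and disappears from \<open>flip P - P\<close>. In what is left, the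
  D-bialgebra axiom produces the terms \<open>F x\<^sub>2 \<otimes> m x\<^sub>1 (f y)\<close> and \<open>m x\<^sub>1 (f y) \<otimes> F x\<^sub>2\<close>, and those with
  \<open>x\<close> and \<open>y\<close> exchanged. They also occur in \<open>flip Q - Q\<close> with the same signs, and once they are cancelled
  the difference of the two sides is the assumed expression.
\<close>

lemma special_compatibility:
  assumes hyp: "class2 s
        (sweedler (\<delta> (f y)) (\<lambda>u1 u2. u1 \<otimes> F (m x u2))
       - sweedler (\<delta> (f y)) (\<lambda>u1 u2. F (m x u2) \<otimes> u1)
       + sweedler (\<delta> x) (\<lambda>x1 x2. F x2 \<otimes> g (m x1 y))
       - sweedler (\<delta> x) (\<lambda>x1 x2. g (m x1 y) \<otimes> F x2)
       + sweedler (\<delta> (G x)) (\<lambda>v1 v2. v2 \<otimes> m v1 (f y))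
       - sweedler (\<delta> (G x)) (\<lambda>v1 v2. m v1 (f y) \<otimes> v2)
       + sweedler (\<delta> (G x)) (\<lambda>v1 v2. v2 \<otimes> g (m v1 y))
       - sweedler (\<delta> (G x)) (\<lambda>v1 v2. g (m v1 y) \<otimes> v2)
       + sweedler (\<delta> (f x)) (\<lambda>u1 u2. F (m y u2) \<otimes> u1)
       - sweedler (\<delta> (f x)) (\<lambda>u1 u2. u1 \<otimes> F (m y u2))
       - sweedler (\<delta> y) (\<lambda>y1 y2. F y2 \<otimes> g (m y1 x))
       + sweedler (\<delta> y) (\<lambda>y1 y2. g (m y1 x) \<otimes> F y2)
       - sweedler (\<delta> (G y)) (\<lambda>v1 v2. v2 \<otimes> m v1 (f x))
       + sweedler (\<delta> (G y)) (\<lambda>v1 v2. m v1 (f x) \<otimes> v2)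
       - sweedler (\<delta> (G y)) (\<lambda>v1 v2. v2 \<otimes> g (m v1 x))
       + sweedler (\<delta> (G y)) (\<lambda>v1 v2. g (m v1 x) \<otimes> v2)) = class2 s 0"
  defines "P \<equiv> sweedler (coalg.\<Delta> (bracket x y - bracket y x)) (\<lambda>z1 z2. z1 \<otimes> z2)"
    and "Q \<equiv> sweedler (coalg.\<Delta> x) (\<lambda>x1 x2. bracket x1 y \<otimes> x2)
            - sweedler (coalg.\<Delta> y) (\<lambda>y1 y2. bracket y1 x \<otimes> y2)"
  shows "class2 s (flip P - P) = class2 s (flip Q - Q)"
  unfolding class2_eq_iff_pairing
proof (intro allI impI)
  fix \<phi> assume \<phi>: "bilinear_form s \<phi>"
  note lin = linearity coalg.linearity
  have bil: "bilinear_form s (\<lambda>a b. \<phi> b a)" "bilinear_form s (\<lambda>a b. \<phi> a (F b))"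
    "bilinear_form s (\<lambda>a b. \<phi> (F b) a)"
    "bilinear_form s (\<lambda>a b. \<phi> (bracket a z) b)" "bilinear_form s (\<lambda>a b. \<phi> b (bracket a z))" for z
    using \<phi> by (simp_all add: bilinear_form_def special_bracket_def lin distrib_left)
  \<comment> \<open>The first equation is one of functions: additivity is also needed for terms
    \<open>\<lambda>a. \<phi> (h a + k a)\<close>, into which \<open>\<lambda>a b. \<phi> (h a + k a) b\<close> eta-contracts.\<close>
  have \<phi>_add: "\<phi> (a + a') = (\<lambda>b. \<phi> a b + \<phi> a' b)" "\<phi> a (b + b') = \<phi> a b + \<phi> a b'" for a a' b b'
    using \<phi> by (simp_all add: bilinear_form_def fun_eq_iff)
  have P: "pairing (\<lambda>(a, b). \<phi> a b) (flip P - P)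
      = contract (\<delta> (m x (f y) - m y (f x))) (\<lambda>a b. \<phi> (F b) a)
      - contract (\<delta> (m x (f y) - m y (f x))) (\<lambda>a b. \<phi> a (F b))"
    by (simp add: P_def bracket_commutator coalg.contract_special \<phi> bil coalg.contract_swap[OF \<phi>])
  have Q: "pairing (\<lambda>(a, b). \<phi> a b) (flip Q - Q)
      = (contract (\<delta> x) (\<lambda>a b. \<phi> (F b) (bracket a y)) + contract (\<delta> (G x)) (\<lambda>a b. \<phi> b (bracket a y)))
      - (contract (\<delta> y) (\<lambda>a b. \<phi> (F b) (bracket a x)) + contract (\<delta> (G y)) (\<lambda>a b. \<phi> b (bracket a x)))
      - (contract (\<delta> x) (\<lambda>a b. \<phi> (bracket a y) (F b)) + contract (\<delta> (G x)) (\<lambda>a b. \<phi> (bracket a y) b))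
      + (contract (\<delta> y) (\<lambda>a b. \<phi> (bracket a x) (F b)) + contract (\<delta> (G y)) (\<lambda>a b. \<phi> (bracket a x) b))"
    by (simp add: Q_def coalg.contract_special bil)
  have "pairing (\<lambda>(a, b). \<phi> a b) (flip Q - Q) - pairing (\<lambda>(a, b). \<phi> a b) (flip P - P) = 0"
    using hyp[unfolded class2_eq_iff_pairing, rule_format, OF \<phi>]
    unfolding P Q
    by (simp add: coalg.contract_diff contract_mult bil special_bracket_def \<phi>_add contract_simps
        algebra_simps)
  then show "pairing (\<lambda>(a, b). \<phi> a b) (flip P - P) = pairing (\<lambda>(a, b). \<phi> a b) (flip Q - Q)"
    by simp
qed

end

theorem theorem4p8:
  fixes s :: "'k::field_char_0 \<Rightarrow> 'a::ab_group_add \<Rightarrow> 'a"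
    and m :: "'a \<Rightarrow> 'a \<Rightarrow> 'a"  (infixl "\<cdot>" 80)
    and \<delta> :: "'a \<Rightarrow> ('a \<times> 'a \<Rightarrow>\<^sub>0 'k) set"
    and f g F G :: "'a \<Rightarrow> 'a"
  assumes "vector_space s"
    and "Vector_Spaces.linear s s f" and "Vector_Spaces.linear s s g"
    and "Vector_Spaces.linear s s F" and "Vector_Spaces.linear s s G"
    and "f \<circ> g = g \<circ> f" and "f \<circ> F = F \<circ> f" and "f \<circ> G = G \<circ> f"
    and "g \<circ> F = F \<circ> g" and "g \<circ> G = G \<circ> g" and "F \<circ> G = G \<circ> F"
    and "nijenhuis_assoc_D_bialgebra s (\<cdot>) \<delta> f F"
    and "\<And>x y. class2 s
        (sweedler (\<delta> (f y)) (\<lambda>u1 u2. u1 \<otimes> F (x \<cdot> u2))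
       - sweedler (\<delta> (f y)) (\<lambda>u1 u2. F (x \<cdot> u2) \<otimes> u1)
       + sweedler (\<delta> x) (\<lambda>x1 x2. F x2 \<otimes> g (x1 \<cdot> y))
       - sweedler (\<delta> x) (\<lambda>x1 x2. g (x1 \<cdot> y) \<otimes> F x2)
       + sweedler (\<delta> (G x)) (\<lambda>v1 v2. v2 \<otimes> v1 \<cdot> f y)
       - sweedler (\<delta> (G x)) (\<lambda>v1 v2. v1 \<cdot> f y \<otimes> v2)
       + sweedler (\<delta> (G x)) (\<lambda>v1 v2. v2 \<otimes> g (v1 \<cdot> y))
       - sweedler (\<delta> (G x)) (\<lambda>v1 v2. g (v1 \<cdot> y) \<otimes> v2)
       + sweedler (\<delta> (f x)) (\<lambda>u1 u2. F (y \<cdot> u2) \<otimes> u1)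
       - sweedler (\<delta> (f x)) (\<lambda>u1 u2. u1 \<otimes> F (y \<cdot> u2))
       - sweedler (\<delta> y) (\<lambda>y1 y2. F y2 \<otimes> g (y1 \<cdot> x))
       + sweedler (\<delta> y) (\<lambda>y1 y2. g (y1 \<cdot> x) \<otimes> F y2)
       - sweedler (\<delta> (G y)) (\<lambda>v1 v2. v2 \<otimes> v1 \<cdot> f x)
       + sweedler (\<delta> (G y)) (\<lambda>v1 v2. v1 \<cdot> f x \<otimes> v2)
       - sweedler (\<delta> (G y)) (\<lambda>v1 v2. v2 \<otimes> g (v1 \<cdot> x))
       + sweedler (\<delta> (G y)) (\<lambda>v1 v2. g (v1 \<cdot> x) \<otimes> v2))
      = class2 s 0"
  shows "nijenhuis_left_alia_bialgebra s
           (special_bracket (\<cdot>) f g) (special_comultiplication s \<delta> F G) f F"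
proof -
  note D = assms(12)[unfolded nijenhuis_assoc_D_bialgebra_def]
  have comm: "F (f x) = f (F x)" "G (f x) = f (G x)" "G (F x) = F (G x)" "g (f x) = f (g x)"
    "g (F x) = F (g x)" for x
    using assms(6-11) by (simp_all add: fun_eq_iff)
  interpret special_bialgebra s m \<delta> f g F G
    using D assms(2-5) by (simp add: special_bialgebra_def)
  have nij: "nijenhuis_operator s m f" and conij: "nijenhuis_cooperator s \<delta> F"
    and adm: "F (m (f x) y) + m x (F (F y)) = m (f x) (F y) + F (m x (F y))"
    and coadm: "class2 s (sweedler (\<delta> (f x)) (\<lambda>z1 z2. F z1 \<otimes> z2)
                    + sweedler (\<delta> x) (\<lambda>x1 x2. x1 \<otimes> f (f x2)))
        = class2 s (sweedler (\<delta> x) (\<lambda>x1 x2. F x1 \<otimes> f x2)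
                    + sweedler (\<delta> (f x)) (\<lambda>z1 z2. z1 \<otimes> f z2))" for x y
    using D by auto
  have "left_alia_bialgebra s bracket coalg.\<Delta>"
    unfolding left_alia_bialgebra_def Let_def
    using left_alia_algebra_bracket coalg.left_alia_coalgebra_special special_compatibility[OF assms(13)]
    by simp
  then show ?thesis
    unfolding nijenhuis_left_alia_bialgebra_def
    using nijenhuis_operator_bracket[OF nij comm(4)] coalg.nijenhuis_cooperator_special[OF conij comm(3)]
      bracket_admissible[OF assms(4) comm(1,5) adm]
      coalg.coadmissible_special[OF assms(2) comm(1,2) coadm]
    by blast
qed

end
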